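(* Let $k\ge 0$, let $U_s$ be a domain in $\mathbb{S}^n$, and let $f: U_s\times\mathbb{R}^n\to Cl_{n+1}$ be such that for each $x_s\in U_s$ the function $u\mapsto f(x_s,u)$ is a left monogenic polynomial homogeneous of degree $k$ in $u$. Then for every $x\in\mathbb{R}^n$ with $x_s:=C(x)\in U_s$, $$P_{k,w}\,J(C,x)\,f\Big(C(x),\frac{(x+e_{n+1})w(x+e_{n+1})}{\|x+e_{n+1}\|^2}\Big)=J(C,x)\,P_{k,u}f(x_s,u),$$ where $u=\dfrac{(x+e_{n+1})w(x+e_{n+1})}{\|x+e_{n+1}\|^2}\in\mathbb{R}^n$ and $J(C,x)=\dfrac{x+e_{n+1}}{\|x+e_{n+1}\|^n}$.
   Context: $Cl_{n+1}$ is the real Clifford algebra generated by $\mathbb{R}^{n+1}$ with orthonormal basis $e_1,\dots,e_{n+1}$ and relations $e_ie_j+e_je_i=-2\delta_{ij}$; $\mathbb{R}^n=\mathrm{span}(e_1,\dots,e_n)\subset\mathbb{R}^{n+1}\subset Cl_{n+1}$, and products of vectors are Clifford products. $\mathbb{S}^n$ is the unit sphere of $\mathbb{R}^{n+1}$. The Cayley transformation is $C:\mathbb{R}^n\to\mathbb{S}^n\setminus\{e_{n+1}\}$, $C(x)=(e_{n+1}x+1)(x+e_{n+1})^{-1}$. Let $H$ be an $n$-dimensional linear subspace of $\mathbb{R}^{n+1}$ with orthonormal basis $\varepsilon_1,\dots,\varepsilon_n$. Its Dirac operator is $D_H=\sum_j\varepsilon_j\partial_{\varepsilon_j}$ (independent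 of the basis). $\mathcal{H}_k(H)$ is the space of $Cl_{n+1}$-valued harmonic polynomials on $H$ homogeneous of degree $k$, and $\mathcal{M}_k(H)$ is the space of $Cl_{n+1}$-valued polynomials $p$ on $H$ homogeneous of degree $k$ with $D_Hp=0$ (left monogenic); $\mathcal{M}_{-1}(H)=0$. The Almansi-Fischer decomposition is $\mathcal{H}_k(H)=\mathcal{M}_k(H)\oplus w\,\mathcal{M}_{k-1}(H)$, $w\in H$ the variable; the projection $P_k:\mathcal{H}_k(H)\to\mathcal{M}_k(H)$ is taken along this decomposition. For $H=\mathbb{R}^n$ with variable $u$ it is written $P_{k,u}$. "Left monogenic in $u$" means in $\mathcal{M}_k(\mathbb{R}^n)$. For fixed $x\in\mathbb{R}^n$ put $a=\frac{x+e_{n+1}}{\|x+e_{n+1}\|}$, a unit vector. The variable $w$ ranges over the hyperplane $a\mathbb{R}^na=\{w\in\mathbb{R}^{n+1}:awa\in\mathbb{R}^n\}$ of $\mathbb{R}^{n+1}$, and $P_{k,w}$ is the projection for $H=a\mathbb{R}^na$, applied to the displayed expression as a function of $w$ with $x$ fixed. *)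

theory Defs
  imports "HOL-Analysis.Analysis" "HOL-Library.FuncSet"
begin

section \<open>The real Clifford algebra on an orthonormal family indexed by a finite type\<close>

text \<open>
  An element is given by its coefficients with respect to the basis of blades
  \<open>e\<^sub>A = e\<^sub>i\<^sub>1 \<cdots> e\<^sub>i\<^sub>r\<close>, where \<open>A = {i\<^sub>1 < \<cdots> < i\<^sub>r}\<close>.  The order on the index type used to
  write out the blades is the one induced by \<^const>\<open>to_nat\<close>.
\<close>

typedef 'm clifford = "UNIV :: ('m set \<Rightarrow> real) set"
  morphisms coeff Clifford ..

setup_lifting type_definition_clifford

lemma clifford_eq_iff: "x = y \<longleftrightarrow> (\<forall>A. coeff x A = coeff y A)"
  by (metis coeff_inject ext)

text \<open>
  The sign in \<open>e\<^sub>A e\<^sub>B = \<plusminus> e\<^bsub>A \<triangle> B\<^esub>\<close>: one factor \<open>-1\<close> for each transposition needed to sort the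
  product and one for each \<open>e\<^sub>i\<^sup>2 = -1\<close>.
\<close>

definition blade_sign :: "'m::finite set \<Rightarrow> 'm set \<Rightarrow> real" where
  "blade_sign A B = (\<Prod>i\<in>A. \<Prod>j\<in>B. if to_nat i \<ge> to_nat j then - 1 else 1)"

lemma blade_sign_sq: "blade_sign A B * blade_sign A B = 1"
  unfolding blade_sign_def prod.distrib[symmetric] by (auto intro!: prod.neutral)

lemma prod_sym_diff_signs:
  fixes g :: "'m::finite \<Rightarrow> real"
  assumes "\<And>i. g i * g i = 1"
  shows "prod g (sym_diff A B) = prod g A * prod g B"
proof -
  have A: "prod g A = prod g (A - B) * prod g (A \<inter> B)"
    by (subst prod.union_disjoint[symmetric]) (auto intro: arg_cong2[where f = prod])
  have B: "prod g B = prod g (B - A) * prod g (A \<inter> B)"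
    by (subst prod.union_disjoint[symmetric]) (auto intro: arg_cong2[where f = prod])
  have I: "prod g (A \<inter> B) * prod g (A \<inter> B) = 1"
    unfolding prod.distrib[symmetric] by (simp add: assms)
  have "prod g (sym_diff A B) = prod g (A - B) * prod g (B - A)"
    by (subst prod.union_disjoint) auto
  also have "\<dots> = prod g (A - B) * prod g (B - A) * (prod g (A \<inter> B) * prod g (A \<inter> B))"
    by (simp add: I)
  finally show ?thesis unfolding A B by (simp only: mult_ac)
qed

lemma blade_sign_sym_diff_left:
  "blade_sign (sym_diff A B) C = blade_sign A C * blade_sign B C"
  unfolding blade_sign_def
  by (rule prod_sym_diff_signs) (auto simp: prod.distrib[symmetric] intro!: prod.neutral)

lemma blade_sign_sym_diff_right:
  "blade_sign A (sym_diff B C) = blade_sign A B * blade_sign A C"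
  unfolding blade_sign_def prod.distrib[symmetric]
  by (intro prod.cong refl prod_sym_diff_signs) auto

instantiation clifford :: (finite) real_algebra_1
begin

lift_definition zero_clifford :: "'a clifford" is "\<lambda>A. 0" .
lift_definition one_clifford :: "'a clifford" is "\<lambda>A. if A = {} then 1 else 0" .
lift_definition plus_clifford :: "'a clifford \<Rightarrow> 'a clifford \<Rightarrow> 'a clifford"
  is "\<lambda>x y A. x A + y A" .
lift_definition minus_clifford :: "'a clifford \<Rightarrow> 'a clifford \<Rightarrow> 'a clifford"
  is "\<lambda>x y A. x A - y A" .
lift_definition uminus_clifford :: "'a clifford \<Rightarrow> 'a clifford"
  is "\<lambda>x A. - x A" .
lift_definition scaleR_clifford :: "real \<Rightarrow> 'a clifford \<Rightarrow> 'a clifford"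
  is "\<lambda>r x A. r * x A" .

text \<open>The second factor of a product of blades equal to \<open>\<plusminus> e\<^sub>C\<close> is determined by the first.\<close>
lift_definition times_clifford :: "'a clifford \<Rightarrow> 'a clifford \<Rightarrow> 'a clifford"
  is "\<lambda>x y C. \<Sum>A\<in>UNIV. blade_sign A (sym_diff A C) * x A * y (sym_diff A C)" .

instance
proof
  fix a b c :: "'a clifford" and r s :: real
  show "a + b + c = a + (b + c)" by transfer (simp add: add.assoc)
  show "a + b = b + a" by transfer (simp add: add.commute)
  show "0 + a = a" by transfer simp
  show "- a + a = 0" by transfer simp
  show "a - b = a + - b" by transfer simp
  show "r *\<^sub>R (a + b) = r *\<^sub>R a + r *\<^sub>R b" by transfer (simp add: distrib_left)
  show "(r + s) *\<^sub>R a = r *\<^sub>R a + s *\<^sub>R a" by transfer (simp add: distrib_right)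
  show "r *\<^sub>R s *\<^sub>R a = (r * s) *\<^sub>R a" by transfer (simp add: mult.assoc)
  show "1 *\<^sub>R a = a" by transfer simp
  show "(a + b) * c = a * c + b * c"
    by transfer (simp add: distrib_left distrib_right sum.distrib)
  show "a * (b + c) = a * b + a * c"
    by transfer (simp add: distrib_left sum.distrib)
  show "r *\<^sub>R a * b = r *\<^sub>R (a * b)"
    by transfer (simp add: sum_distrib_left mult_ac)
  show "a * r *\<^sub>R b = r *\<^sub>R (a * b)"
    by transfer (simp add: sum_distrib_left mult_ac)
  show "(0 :: 'a clifford) \<noteq> 1"
    by transfer (auto simp: fun_eq_iff)
  show "1 * a = a"
  proof (transfer, rule ext)
    fix x :: "'a set \<Rightarrow> real" and C
    have "(\<Sum>A\<in>UNIV. blade_sign A (sym_diff A C) * (if A = {} then 1 else 0) * x (sym_diff A C))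
        = (\<Sum>A\<in>(UNIV :: 'a set set). if A = {} then x C else 0)"
      by (rule sum.cong[OF refl]) (simp add: blade_sign_def)
    then show "(\<Sum>A\<in>UNIV. blade_sign A (sym_diff A C) * (if A = {} then 1 else 0)
        * x (sym_diff A C)) = x C" by simp
  qed
  show "a * 1 = a"
  proof (transfer, rule ext)
    fix x :: "'a set \<Rightarrow> real" and C
    have "(\<Sum>A\<in>UNIV. blade_sign A (sym_diff A C) * x A * (if sym_diff A C = {} then 1 else 0))
        = (\<Sum>A\<in>UNIV. if A = C then x C else 0)"
      by (intro sum.cong refl) (auto simp: blade_sign_def)
    then show "(\<Sum>A\<in>UNIV. blade_sign A (sym_diff A C) * x A
        * (if sym_diff A C = {} then 1 else 0)) = x C" by simp
  qed
  show "a * b * c = a * (b * c)"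
  proof (transfer, rule ext)
    fix x y z :: "'a set \<Rightarrow> real" and D
    let ?s = "blade_sign :: 'a set \<Rightarrow> 'a set \<Rightarrow> real"
    have "(\<Sum>A\<in>UNIV. ?s A (sym_diff A D) * (\<Sum>B\<in>UNIV. ?s B (sym_diff B A) * x B * y (sym_diff B A))
            * z (sym_diff A D))
        = (\<Sum>A\<in>UNIV. \<Sum>B\<in>UNIV. ?s A (sym_diff A D) * (?s B (sym_diff B A) * x B * y (sym_diff B A))
            * z (sym_diff A D))"
      by (simp add: sum_distrib_left sum_distrib_right)
    also have "\<dots> = (\<Sum>B\<in>UNIV. \<Sum>A\<in>UNIV. ?s A (sym_diff A D)
            * (?s B (sym_diff B A) * x B * y (sym_diff B A)) * z (sym_diff A D))"
      by (rule sum.swap)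
    also have "\<dots> = (\<Sum>B\<in>UNIV. \<Sum>A\<in>UNIV. ?s B (sym_diff B D) * x B
            * (?s A (sym_diff A (sym_diff B D)) * y A * z (sym_diff A (sym_diff B D))))"
    proof (rule sum.cong[OF refl])
      fix B :: "'a set"
      show "(\<Sum>A\<in>UNIV. ?s A (sym_diff A D) * (?s B (sym_diff B A) * x B * y (sym_diff B A))
              * z (sym_diff A D))
          = (\<Sum>A\<in>UNIV. ?s B (sym_diff B D) * x B
            * (?s A (sym_diff A (sym_diff B D)) * y A * z (sym_diff A (sym_diff B D))))"
      proof -
        have eq: "?s A (sym_diff A D) * (?s B (sym_diff B A) * x B * y (sym_diff B A)) * z (sym_diff A D)
            = ?s B (sym_diff B D) * x B * (?s (sym_diff B A) (sym_diff (sym_diff B A) (sym_diff B D))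
              * y (sym_diff B A) * z (sym_diff (sym_diff B A) (sym_diff B D)))" for A :: "'a set"
        proof -
          have D: "sym_diff (sym_diff B A) (sym_diff B D) = sym_diff A D" by auto
          have "?s A (sym_diff A D) * ?s B (sym_diff B A)
              = ?s B (sym_diff B D) * ?s (sym_diff B A) (sym_diff A D)"
            by (simp add: blade_sign_sym_diff_left blade_sign_sym_diff_right mult_ac)
               (metis (no_types, lifting) blade_sign_sq mult.left_commute mult.commute mult_1)
          then show ?thesis unfolding D by (simp add: mult_ac)
        qed
        show ?thesis
          unfolding eq
          by (rule sum.reindex_bij_witness[where i = "sym_diff B" and j = "sym_diff B"]) auto
      qed
    qed
    also have "\<dots> = (\<Sum>B\<in>UNIV. ?s B (sym_diff B D) * x B
            * (\<Sum>A\<in>UNIV. ?s A (sym_diff A (sym_diff B D)) * y A * z (sym_diff A (sym_diff B D))))"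
      by (simp add: sum_distrib_left)
    finally show "(\<Sum>A\<in>UNIV. ?s A (sym_diff A D)
            * (\<Sum>B\<in>UNIV. ?s B (sym_diff B A) * x B * y (sym_diff B A)) * z (sym_diff A D))
        = (\<Sum>B\<in>UNIV. ?s B (sym_diff B D) * x B
            * (\<Sum>A\<in>UNIV. ?s A (sym_diff A (sym_diff B D)) * y A * z (sym_diff A (sym_diff B D))))" .
  qed
qed

end

lift_definition blade :: "'m::finite set \<Rightarrow> 'm clifford"
  is "\<lambda>A B. if B = A then 1 else 0" .

text \<open>The Euclidean structure makes the blades orthonormal.\<close>

instantiation clifford :: (finite) euclidean_space
begin

lift_definition inner_clifford :: "'a clifford \<Rightarrow> 'a clifford \<Rightarrow> real"
  is "\<lambda>x y. \<Sum>A\<in>UNIV. x A * y A" .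

definition norm_clifford :: "'a clifford \<Rightarrow> real" where
  "norm_clifford x = sqrt (inner x x)"
definition dist_clifford :: "'a clifford \<Rightarrow> 'a clifford \<Rightarrow> real" where
  "dist_clifford x y = norm (x - y)"
definition sgn_clifford :: "'a clifford \<Rightarrow> 'a clifford" where
  "sgn_clifford x = inverse (norm x) *\<^sub>R x"
definition uniformity_clifford :: "('a clifford \<times> 'a clifford) filter" where
  "uniformity_clifford = (INF e\<in>{0<..}. principal {(x, y). dist x y < e})"
definition open_clifford :: "'a clifford set \<Rightarrow> bool" where
  "open_clifford U \<longleftrightarrow> (\<forall>x\<in>U. eventually (\<lambda>(x', y). x' = x \<longrightarrow> y \<in> U) uniformity)"
definition Basis_clifford :: "'a clifford set" where
  "Basis_clifford = range blade"

instance
proof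
  fix x y z :: "'a clifford" and r :: real and U :: "'a clifford set"
  show "inner x y = inner y x" by transfer (simp add: mult.commute)
  show "inner (x + y) z = inner x z + inner y z"
    by transfer (simp add: distrib_right sum.distrib)
  show "inner (r *\<^sub>R x) y = r * inner x y"
    by transfer (simp add: sum_distrib_left mult.assoc)
  show "0 \<le> inner x x" by transfer (simp add: sum_nonneg)
  show "inner x x = 0 \<longleftrightarrow> x = 0"
    by transfer (simp add: sum_nonneg_eq_0_iff fun_eq_iff)
  show "norm x = sqrt (inner x x)" by (fact norm_clifford_def)
  show "dist x y = norm (x - y)" by (fact dist_clifford_def)
  show "sgn x = inverse (norm x) *\<^sub>R x" by (fact sgn_clifford_def)
  show "uniformity = (INF e\<in>{0<..}. principal {(x, y::'a clifford). dist x y < e})"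
    by (fact uniformity_clifford_def)
  show "open U \<longleftrightarrow> (\<forall>x\<in>U. \<forall>\<^sub>F (x', y) in uniformity. x' = x \<longrightarrow> y \<in> U)"
    by (fact open_clifford_def)
  show "(Basis :: 'a clifford set) \<noteq> {}" "finite (Basis :: 'a clifford set)"
    by (simp_all add: Basis_clifford_def)
  show "inner u v = (if u = v then 1 else 0)" if uv: "u \<in> Basis" "v \<in> Basis"
    for u v :: "'a clifford"
  proof -
    obtain A B where AB: "u = blade A" "v = blade B"
      using uv unfolding Basis_clifford_def by blast
    have "inner (blade A) (blade B) = (if A = B then 1 else 0)"
      by transfer (auto simp: if_distrib[of "\<lambda>t. t * _"] cong: if_cong)
    moreover have "blade A = blade B \<longleftrightarrow> A = B"
      by transfer (auto simp: fun_eq_iff; metis zero_neq_one)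
    ultimately show ?thesis using AB by simp
  qed
  have "inner x (blade A) = coeff x A" for A
    by transfer (auto simp: if_distrib[of "\<lambda>t. _ * t"] cong: if_cong)
  then show "(\<forall>u\<in>Basis. inner x u = 0) \<longleftrightarrow> x = 0"
    by (auto simp: Basis_clifford_def clifford_eq_iff zero_clifford.rep_eq)
qed

end

definition gen :: "'m::finite \<Rightarrow> 'm clifford" where
  "gen i = blade {i}"

lemma inj_blade: "inj (blade :: 'm::finite set \<Rightarrow> 'm clifford)"
  by (rule injI) (transfer, auto simp: fun_eq_iff; metis zero_neq_one)

lemma DIM_clifford: "DIM('m::finite clifford) = 2 ^ CARD('m)"
  using card_Pow[of "UNIV :: 'm set"]
  by (simp add: Basis_clifford_def card_image inj_blade)

lemma blade_mult: "blade A * blade B = blade_sign A B *\<^sub>R blade (sym_diff A B)"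
proof (transfer, rule ext)
  fix A B C :: "'m::finite set"
  have "(\<Sum>D\<in>UNIV. blade_sign D (sym_diff D C) * (if D = A then 1 else 0)
          * (if sym_diff D C = B then 1 else 0))
      = (\<Sum>D\<in>UNIV. if D = A then blade_sign A (sym_diff A C)
          * (if sym_diff A C = B then 1 else 0) else 0)"
    by (intro sum.cong refl) auto
  moreover have "sym_diff A C = B \<longleftrightarrow> C = sym_diff A B" by auto
  ultimately show "(\<Sum>D\<in>UNIV. blade_sign D (sym_diff D C) * (if D = A then 1 else 0)
          * (if sym_diff D C = B then 1 else 0))
      = blade_sign A B * (if C = sym_diff A B then 1 else 0)"
    by auto
qed

lemma blade_empty: "blade {} = 1"
  by transfer auto

lemma inner_gen: "inner (gen i) (gen j) = (if i = j then 1 else 0)"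
proof -
  have "inner (gen i) (gen j) = (if gen i = gen j then 1 else 0)"
    by (rule inner_Basis) (simp_all add: gen_def Basis_clifford_def)
  then show ?thesis
    by (simp add: gen_def inj_eq[OF inj_blade])
qed

lemma clifford_relations:
  "gen i * gen j + gen j * gen i = (if i = j then - 2 else 0)"
proof (cases "i = j")
  case True
  then show ?thesis
    by (simp add: gen_def blade_mult blade_sign_def blade_empty)
next
  case False
  then have "to_nat i \<noteq> to_nat j" by simp
  moreover have "sym_diff {i} {j} = sym_diff {j} {i}" by auto
  ultimately show ?thesis using False
    by (auto simp: gen_def blade_mult blade_sign_def)
qed

section \<open>Vectors, the sphere and the Cayley transformation\<close>

text \<open>
  With \<open>n = CARD('n)\<close>, the index type \<open>'n option\<close> stands for \<open>{1, \<dots>, n + 1}\<close>: the vectors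
  \<open>gen (Some i)\<close> are \<open>e\<^sub>1, \<dots>, e\<^sub>n\<close> and \<open>gen None\<close> is \<open>e\<^bsub>n+1\<^esub>\<close>.  The spaces
  \<open>\<real>\<^sup>n \<subseteq> \<real>\<^bsup>n+1\<^esup>\<close> are subspaces of the Clifford algebra.
\<close>

definition vectors :: "'m::finite clifford set" where
  "vectors = span (range gen)"

definition hyper_vectors :: "'n::finite option clifford set" where
  "hyper_vectors = span (range (\<lambda>i. gen (Some i)))"

definition unit_vectors :: "'m::finite clifford set" where
  "unit_vectors = {x \<in> vectors. norm x = 1}"

abbreviation e_last :: "'n::finite option clifford" where
  "e_last \<equiv> gen None"

definition ring_inverse :: "'a::ring_1 \<Rightarrow> 'a" where
  "ring_inverse x = (THE y. x * y = 1 \<and> y * x = 1)"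

definition cayley :: "'n::finite option clifford \<Rightarrow> 'n option clifford" where
  "cayley x = (e_last * x + 1) * ring_inverse (x + e_last)"

definition cayley_weight :: "'n::finite option clifford \<Rightarrow> 'n option clifford" where
  "cayley_weight x = (x + e_last) /\<^sub>R norm (x + e_last) ^ CARD('n)"

section \<open>Monogenic and harmonic polynomials on a subspace\<close>

text \<open>
  Functions on a subspace \<open>H\<close> are represented by elements of \<^term>\<open>extensional H\<close>, so that two of
  them are equal iff they agree on \<open>H\<close>.
\<close>

definition orthonormal_basis :: "'m::finite clifford set \<Rightarrow> 'm clifford set \<Rightarrow> bool" where
  "orthonormal_basis H B \<longleftrightarrow> pairwise orthogonal B \<and> (\<forall>b\<in>B. norm b = 1) \<and> span B = H"

definition some_onb :: "'m::finite clifford set \<Rightarrow> 'm clifford set" where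
  "some_onb H = (SOME B. orthonormal_basis H B)"

definition dir_deriv ::
  "'m::finite clifford \<Rightarrow> ('m clifford \<Rightarrow> 'm clifford) \<Rightarrow> 'm clifford \<Rightarrow> 'm clifford" where
  "dir_deriv v p w = vector_derivative (\<lambda>t. p (w + t *\<^sub>R v)) (at 0)"

text \<open>Both operators are applied at points of \<open>H\<close> only.\<close>

definition dirac ::
  "'m::finite clifford set \<Rightarrow> ('m clifford \<Rightarrow> 'm clifford) \<Rightarrow> 'm clifford \<Rightarrow> 'm clifford" where
  "dirac H p w = (\<Sum>b\<in>some_onb H. b * dir_deriv b p w)"

definition laplacian ::
  "'m::finite clifford set \<Rightarrow> ('m clifford \<Rightarrow> 'm clifford) \<Rightarrow> 'm clifford \<Rightarrow> 'm clifford" where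
  "laplacian H p w = (\<Sum>b\<in>some_onb H. dir_deriv b (dir_deriv b p) w)"

definition homogeneous_polys ::
  "nat \<Rightarrow> 'm::finite clifford set \<Rightarrow> ('m clifford \<Rightarrow> 'm clifford) set" where
  "homogeneous_polys k H = {p \<in> extensional H.
     (\<exists>q. polynomial_function q \<and> (\<forall>w\<in>H. p w = q w)) \<and>
     (\<forall>w\<in>H. \<forall>t. p (t *\<^sub>R w) = t ^ k *\<^sub>R p w)}"

definition harmonic_polys ::
  "nat \<Rightarrow> 'm::finite clifford set \<Rightarrow> ('m clifford \<Rightarrow> 'm clifford) set" where
  "harmonic_polys k H = {p \<in> homogeneous_polys k H. \<forall>w\<in>H. laplacian H p w = 0}"

definition monogenic_polys ::
  "nat \<Rightarrow> 'm::finite clifford set \<Rightarrow> ('m clifford \<Rightarrow> 'm clifford) set" where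
  "monogenic_polys k H = {p \<in> homogeneous_polys k H. \<forall>w\<in>H. dirac H p w = 0}"

text \<open>The complement \<open>w \<M>\<^bsub>k-1\<^esub>(H)\<close> of \<open>\<M>\<^sub>k(H)\<close>, with \<open>\<M>\<^bsub>-1\<^esub>(H) = 0\<close>.\<close>

definition fischer_complement ::
  "nat \<Rightarrow> 'm::finite clifford set \<Rightarrow> ('m clifford \<Rightarrow> 'm clifford) set" where
  "fischer_complement k H =
     (case k of 0 \<Rightarrow> {\<lambda>w\<in>H. 0} | Suc j \<Rightarrow> (\<lambda>q. \<lambda>w\<in>H. w * q w) ` monogenic_polys j H)"

definition fischer_proj ::
  "nat \<Rightarrow> 'm::finite clifford set \<Rightarrow> ('m clifford \<Rightarrow> 'm clifford) \<Rightarrow> 'm clifford \<Rightarrow> 'm clifford" where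
  "fischer_proj k H = (\<lambda>h\<in>harmonic_polys k H.
     THE p. p \<in> monogenic_polys k H \<and> (\<exists>r\<in>fischer_complement k H. \<forall>w\<in>H. h w = p w + r w))"

lemma orthonormal_basis_some_onb:
  fixes H :: "'m::finite clifford set"
  assumes "subspace H"
  shows "orthonormal_basis H (some_onb H)"
proof -
  obtain B where "pairwise orthogonal B" "\<And>b. b \<in> B \<Longrightarrow> norm b = 1" "span B = H"
    using orthonormal_basis_subspace[OF assms] by metis
  then have "orthonormal_basis H B" by (simp add: orthonormal_basis_def)
  then show ?thesis unfolding some_onb_def by (rule someI)
qed

lemma dirac_eq_sum_onb:
  fixes H :: "'m::finite clifford set"
  assumes H: "subspace H" and p: "p \<in> homogeneous_polys k H" and w: "w \<in> H"
    and B: "orthonormal_basis H B"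
  shows "dirac H p w = (\<Sum>b\<in>B. b * dir_deriv b p w)"
proof -
  obtain q where q: "polynomial_function q" "\<And>v. v \<in> H \<Longrightarrow> p v = q v"
    using p unfolding homogeneous_polys_def by blast
  obtain q' where q': "(q has_derivative q') (at w)"
    using differentiable_at_polynomial_function[OF q(1)] unfolding differentiable_def by blast
  then have lin: "linear q'" by (rule has_derivative_linear)
  have dd: "dir_deriv v p w = q' v" if v: "v \<in> H" for v
  proof -
    have "((\<lambda>t. w + t *\<^sub>R v) has_derivative (\<lambda>t. t *\<^sub>R v)) (at 0)"
      by (auto intro!: derivative_eq_intros)
    moreover have "(q has_derivative q') (at (w + 0 *\<^sub>R v))" using q' by simp
    ultimately have "((\<lambda>t. q (w + t *\<^sub>R v)) has_derivative (\<lambda>t. q' (t *\<^sub>R v))) (at 0)"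
      by (rule has_derivative_compose)
    then have "((\<lambda>t. q (w + t *\<^sub>R v)) has_vector_derivative q' v) (at 0)"
      by (simp add: has_vector_derivative_def linear_scale[OF lin])
    moreover have "(\<lambda>t. p (w + t *\<^sub>R v)) = (\<lambda>t. q (w + t *\<^sub>R v))"
      using H v w by (auto intro!: q(2) subspace_add subspace_scale)
    ultimately show ?thesis
      unfolding dir_deriv_def by (simp add: vector_derivative_at)
  qed
  have onbD: "finite C" "C \<subseteq> H" "\<And>v. v \<in> H \<Longrightarrow> (\<Sum>c\<in>C. inner v c *\<^sub>R c) = v"
    if C: "orthonormal_basis H C" for C
  proof -
    have pw: "pairwise orthogonal C" and nrm: "\<And>c. c \<in> C \<Longrightarrow> norm c = 1" and sp: "span C = H"
      using C unfolding orthonormal_basis_def by auto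
    show fin: "finite C" using pw by (rule pairwise_orthogonal_imp_finite)
    show "C \<subseteq> H" using sp span_superset by blast
    show "(\<Sum>c\<in>C. inner v c *\<^sub>R c) = v" if "v \<in> H" for v
    proof -
      have v: "v \<in> span C" using that sp by simp
      have ip: "inner c d = (if c = d then 1 else 0)" if "c \<in> C" "d \<in> C" for c d
        using that pw nrm by (auto simp: pairwise_def orthogonal_def dot_square_norm)
      let ?r = "v - (\<Sum>c\<in>C. inner v c *\<^sub>R c)"
      have "?r \<in> span C"
        by (intro span_diff v span_sum span_scale span_base)
      moreover have "orthogonal ?r d" if "d \<in> C" for d
        using that fin
        by (simp add: orthogonal_def inner_diff_left inner_sum_left ip
              if_distrib[of "\<lambda>t. _ * t"] cong: if_cong)
      ultimately have "orthogonal ?r ?r"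
        using orthogonal_to_span by blast
      then show ?thesis by (simp add: orthogonal_self)
    qed
  qed
  let ?C = "some_onb H"
  have C: "orthonormal_basis H ?C" by (rule orthonormal_basis_some_onb[OF H])
  note B' = onbD[OF B] and C' = onbD[OF C]
  have "(\<Sum>b\<in>B. b * q' b) = (\<Sum>b\<in>B. (\<Sum>c\<in>?C. inner b c *\<^sub>R c) * q' b)"
    using B'(2) C'(3) by (intro sum.cong refl) (simp add: subset_iff)
  also have "\<dots> = (\<Sum>b\<in>B. \<Sum>c\<in>?C. c * q' (inner c b *\<^sub>R b))"
    by (simp add: sum_distrib_right linear_scale[OF lin] inner_commute)
  also have "\<dots> = (\<Sum>c\<in>?C. \<Sum>b\<in>B. c * q' (inner c b *\<^sub>R b))"
    by (rule sum.swap)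
  also have "\<dots> = (\<Sum>c\<in>?C. c * q' (\<Sum>b\<in>B. inner c b *\<^sub>R b))"
    by (simp add: sum_distrib_left linear_sum[OF lin])
  also have "\<dots> = (\<Sum>c\<in>?C. c * q' c)"
    using C'(2) B'(3) by (intro sum.cong refl) (simp add: subset_iff)
  finally have "(\<Sum>b\<in>B. b * q' b) = (\<Sum>c\<in>?C. c * q' c)" .
  moreover have "(\<Sum>b\<in>B. b * dir_deriv b p w) = (\<Sum>b\<in>B. b * q' b)"
    using B'(2) by (intro sum.cong refl) (simp add: dd subset_iff)
  moreover have "dirac H p w = (\<Sum>c\<in>?C. c * q' c)"
    unfolding dirac_def using C'(2) by (intro sum.cong refl) (simp add: dd subset_iff)
  ultimately show ?thesis by simp
qed

end

theory Submission
  imports Defs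
begin

text \<open>
  For each value \<open>y\<close> of the Cayley transformation the polynomial \<open>f y\<close> is already monogenic, so
  the theorem amounts to two facts: the projection fixes monogenic polynomials, and the weighted
  pull-back \<open>w \<mapsto> J f(y, a w a)\<close> is again monogenic, on the hyperplane \<open>a \<real>\<^sup>n a\<close>.  Both
  sides then equal \<open>J f(y, u)\<close>.

  The second fact comes from the unit vector \<open>a\<close> having \<open>a\<^sup>2 = -1\<close>.  The map \<open>w \<mapsto> a w a\<close> is
  a reflection, hence an isometric involution of the vectors, and it carries an orthonormal basis
  \<open>b\<close> of \<open>\<real>\<^sup>n\<close> to an orthonormal basis \<open>a b a\<close> of the hyperplane.  The derivative of
  \<open>a p(a w a)\<close> in direction \<open>a b a\<close> is \<open>a (\<partial>\<^sub>b p)(a w a)\<close>, and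
  \<open>(a b a) a = - a b\<close>, so the Dirac operator of the hyperplane applied to \<open>a p(a w a)\<close> gives
  \<open>- a (D p)(a w a)\<close> (\<open>monogenic_polys_unit_vector_conj\<close>).  The weight \<open>J\<close> is a real multiple
  of \<open>a\<close>.

  The first fact (\<open>fischer_proj_monogenic\<close>) has two ingredients.  Monogenic polynomials lie in the
  domain of the projection because \<open>D\<^sup>2 = -\<Delta>\<close> (\<open>monogenic_polys_subset_harmonic_polys\<close>).  The
  decomposition is unique because \<open>D (w q) = -(n + 2 j) q\<close> for \<open>q\<close> monogenic of degree \<open>j\<close> on
  an \<open>n\<close>-dimensional space, which forces \<open>q = 0\<close> whenever \<open>w q\<close> is monogenic
  (\<open>monogenic_decomposition_unique\<close>).
\<close>

section \<open>Clifford products of vectors\<close>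

text \<open>
  The Euclidean norm of the Clifford algebra is not submultiplicative in general, so the product rule for
  normed algebras does not apply; finite dimension still makes the product bounded.
\<close>
lemma bounded_bilinear_clifford_mult:
  "bounded_bilinear ((*) :: 'm::finite clifford \<Rightarrow> 'm clifford \<Rightarrow> 'm clifford)"
  unfolding bilinear_conv_bounded_bilinear[symmetric] bilinear_def
  by (auto intro!: linearI simp: distrib_left distrib_right)

lemma subspace_vectors: "subspace (vectors :: 'm::finite clifford set)"
  unfolding vectors_def by (rule subspace_span)

lemma subspace_hyper_vectors: "subspace (hyper_vectors :: 'n::finite option clifford set)"
  unfolding hyper_vectors_def by (rule subspace_span)

lemma hyper_vectors_subset_vectors: "hyper_vectors \<subseteq> vectors"
  unfolding hyper_vectors_def vectors_def by (rule span_mono) auto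

lemma e_last_in_vectors: "e_last \<in> vectors"
  unfolding vectors_def by (auto intro: span_base)

lemma inner_e_last_hyper_vectors:
  assumes "x \<in> hyper_vectors"
  shows "inner x e_last = 0"
  using assms unfolding hyper_vectors_def
  by (induction rule: span_induct_alt) (auto simp: inner_add_left inner_gen)

text \<open>
  Both sides are bilinear, so the relations between the generators extend to their span.
\<close>
lemma vectors_anticommute:
  assumes "v \<in> vectors" "w \<in> vectors"
  shows "v * w + w * v = (- 2 * inner v w) *\<^sub>R 1"
proof -
  have gen_gen: "gen i * gen j + gen j * gen i = (- 2 * inner (gen i) (gen j)) *\<^sub>R 1"
    for i j :: 'a
    by (simp add: clifford_relations inner_gen scaleR_conv_of_real)
  have gen_w: "gen i * w + w * gen i = (- 2 * inner (gen i) w) *\<^sub>R 1" for i :: 'a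
    using assms(2) unfolding vectors_def
  proof (induction rule: span_induct_alt)
    case (step c y z)
    then obtain j where y: "y = gen j" by auto
    have "gen i * (c *\<^sub>R y + z) + (c *\<^sub>R y + z) * gen i
        = c *\<^sub>R (gen i * gen j + gen j * gen i) + (gen i * z + z * gen i)"
      by (simp add: y algebra_simps)
    then show ?case unfolding step gen_gen by (simp add: y inner_add_right algebra_simps)
  qed simp
  show ?thesis
    using assms(1) unfolding vectors_def
  proof (induction rule: span_induct_alt)
    case (step c y z)
    then obtain j where y: "y = gen j" by auto
    have "(c *\<^sub>R y + z) * w + w * (c *\<^sub>R y + z)
        = c *\<^sub>R (gen j * w + w * gen j) + (z * w + w * z)"
      by (simp add: y algebra_simps)
    then show ?case unfolding step gen_w by (simp add: y inner_add_left algebra_simps)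
  qed simp
qed

lemma vector_square:
  assumes "v \<in> vectors"
  shows "v * v = (- inner v v) *\<^sub>R 1"
proof -
  have "2 *\<^sub>R (v * v) = v * v + v * v" by (rule scaleR_2)
  also have "\<dots> = 2 *\<^sub>R ((- inner v v) *\<^sub>R 1)"
    using vectors_anticommute[OF assms assms] by simp
  finally show ?thesis unfolding scaleR_cancel_left by simp
qed

lemma unit_vector_square:
  assumes "a \<in> unit_vectors"
  shows "a * a = - 1"
  using assms vector_square[of a] by (simp add: unit_vectors_def dot_square_norm)

text \<open>
  Conjugation by a unit vector is the reflection in its orthogonal hyperplane; that it maps vectors
  to vectors, isometrically, is read off from this formula.
\<close>
lemma unit_vector_conj_reflection:
  assumes "a \<in> unit_vectors" "w \<in> vectors"
  shows "a * w * a = w - (2 * inner a w) *\<^sub>R a"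
proof -
  have a: "a \<in> vectors" using assms by (simp add: unit_vectors_def)
  have "w * a = - (a * w) - (2 * inner a w) *\<^sub>R 1"
    using vectors_anticommute[OF a assms(2)] by (simp add: algebra_simps eq_neg_iff_add_eq_0)
  then have "a * w * a = - (a * a) * w - (2 * inner a w) *\<^sub>R a"
    by (simp add: mult.assoc right_diff_distrib)
  then show ?thesis by (simp add: unit_vector_square[OF assms(1)])
qed

lemma unit_vector_conj_in_vectors:
  assumes "a \<in> unit_vectors" "w \<in> vectors"
  shows "a * w * a \<in> vectors"
  using assms unfolding unit_vector_conj_reflection[OF assms]
  by (auto intro!: subspace_diff subspace_scale subspace_vectors simp: unit_vectors_def)

lemma unit_vector_conj_conj:
  assumes "a \<in> unit_vectors"
  shows "a * (a * w * a) * a = w"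
proof -
  have "a * (a * w * a) * a = (a * a) * w * (a * a)" by (simp add: mult.assoc)
  then show ?thesis by (simp add: unit_vector_square[OF assms])
qed

lemma inner_unit_vector_conj:
  assumes "a \<in> unit_vectors" "v \<in> vectors" "w \<in> vectors"
  shows "inner (a * v * a) (a * w * a) = inner v w"
proof -
  have "inner a a = 1" using assms by (simp add: unit_vectors_def dot_square_norm)
  then show ?thesis
    by (simp add: unit_vector_conj_reflection assms inner_diff_left inner_diff_right inner_commute)
qed

lemma linear_clifford_sandwich: "linear (\<lambda>w::'m::finite clifford. a * w * b)"
  by (rule linearI) (simp_all add: algebra_simps)

lemma subspace_unit_vector_conj:
  assumes "subspace K"
  shows "subspace {w \<in> vectors. a * w * a \<in> K}"
proof -
  have "subspace (vectors \<inter> (\<lambda>w. a * w * a) -` K)"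
    by (intro subspace_inter subspace_vectors linear_subspace_vimage linear_clifford_sandwich assms)
  moreover have "vectors \<inter> (\<lambda>w. a * w * a) -` K = {w \<in> vectors. a * w * a \<in> K}" by auto
  ultimately show ?thesis by simp
qed


section \<open>Orthonormal bases\<close>

lemma orthonormal_basis_finite: "orthonormal_basis H B \<Longrightarrow> finite B"
  unfolding orthonormal_basis_def using pairwise_orthogonal_imp_finite by blast

lemma orthonormal_basis_subset: "orthonormal_basis H B \<Longrightarrow> B \<subseteq> H"
  unfolding orthonormal_basis_def using span_superset by blast

lemma orthonormal_basis_inner:
  assumes "orthonormal_basis H B" "b \<in> B" "c \<in> B"
  shows "inner b c = (if b = c then 1 else 0)"
  using assms by (auto simp: orthonormal_basis_def pairwise_def orthogonal_def dot_square_norm)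

lemma orthonormal_basis_expansion:
  assumes B: "orthonormal_basis H B" and v: "v \<in> H"
  shows "(\<Sum>b\<in>B. inner v b *\<^sub>R b) = v"
proof -
  have sp: "v \<in> span B" using B v by (simp add: orthonormal_basis_def)
  have fin: "finite B" by (rule orthonormal_basis_finite[OF B])
  let ?r = "v - (\<Sum>b\<in>B. inner v b *\<^sub>R b)"
  have "?r \<in> span B"
    by (intro span_diff sp span_sum span_scale span_base)
  moreover have "orthogonal ?r d" if "d \<in> B" for d
    using that fin
    by (simp add: orthogonal_def inner_diff_left inner_sum_left orthonormal_basis_inner[OF B]
          if_distrib[of "\<lambda>t. _ * t"] cong: if_cong)
  ultimately have "orthogonal ?r ?r"
    using orthogonal_to_span by blast
  then show ?thesis by (simp add: orthogonal_self)
qed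

text \<open>
  Expressing the Dirac operator of the reflected subspace in the reflected basis is what makes it
  comparable, term by term, with the Dirac operator of \<open>K\<close>.
\<close>
lemma orthonormal_basis_unit_vector_conj:
  assumes a: "a \<in> unit_vectors" and K: "K \<subseteq> vectors" and B: "orthonormal_basis K B"
  shows "orthonormal_basis {w \<in> vectors. a * w * a \<in> K} ((\<lambda>b. a * b * a) ` B)"
proof -
  let ?c = "\<lambda>w. a * w * a"
  have BK: "B \<subseteq> vectors" using orthonormal_basis_subset[OF B] K by blast
  have "span (?c ` B) = ?c ` span B"
    by (rule linear_span_image[OF linear_clifford_sandwich])
  also have "\<dots> = ?c ` K" using B by (simp add: orthonormal_basis_def)
  also have "\<dots> = {w \<in> vectors. ?c w \<in> K}"
  proof (intro equalityI subsetI)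
    fix w assume "w \<in> {w \<in> vectors. ?c w \<in> K}"
    then have "w = ?c (?c w)" "?c w \<in> K" by (simp_all add: unit_vector_conj_conj[OF a])
    then show "w \<in> ?c ` K" by blast
  qed (use K in \<open>auto simp: unit_vector_conj_conj[OF a] intro!: unit_vector_conj_in_vectors[OF a]\<close>)
  finally have "span (?c ` B) = {w \<in> vectors. ?c w \<in> K}" .
  moreover have "pairwise orthogonal (?c ` B)"
    using B BK
    by (auto simp: orthonormal_basis_def pairwise_def orthogonal_def inner_unit_vector_conj[OF a]
        subset_iff)
  moreover have "norm (?c b) = 1" if "b \<in> B" for b
    using that B BK
    by (auto simp: orthonormal_basis_def norm_eq_sqrt_inner inner_unit_vector_conj[OF a] subset_iff)
  ultimately show ?thesis by (auto simp: orthonormal_basis_def)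
qed


section \<open>Directional derivatives of polynomials\<close>

text \<open>
  Partial derivatives commute.  For polynomials this needs no analysis: both derivatives are carried
  through the inductive generation of the polynomials, and the product rule produces a symmetric
  second derivative from symmetric ones.
\<close>
lemma real_polynomial_function_second_derivative:
  fixes q :: "'a::real_normed_vector \<Rightarrow> real"
  assumes "real_polynomial_function q"
  shows "\<exists>F G. (\<forall>x. (q has_derivative F x) (at x)) \<and>
    (\<forall>x v. ((\<lambda>x. F x v) has_derivative G x v) (at x)) \<and> (\<forall>x u v. G x u v = G x v u)"
    (is "\<exists>F G. ?P q F G")
  using assms
proof (induction rule: real_polynomial_function.induct)
  case (linear f)
  have "?P f (\<lambda>x. f) (\<lambda>x u v. 0)"
    using linear by (simp add: bounded_linear_imp_has_derivative)
  then show ?case by (intro exI)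
next
  case (const c)
  have "?P (\<lambda>x. c) (\<lambda>x u. 0) (\<lambda>x u v. 0)" by simp
  then show ?case by (intro exI)
next
  case (add f g)
  obtain F F2 where F: "?P f F F2" using add.IH(1) by (elim exE)
  obtain G G2 where G: "?P g G G2" using add.IH(2) by (elim exE)
  note F' = F[THEN conjunct1, rule_format] F[THEN conjunct2, THEN conjunct1, rule_format]
  note G' = G[THEN conjunct1, rule_format] G[THEN conjunct2, THEN conjunct1, rule_format]
  have "?P (\<lambda>x. f x + g x) (\<lambda>x u. F x u + G x u) (\<lambda>x u v. F2 x u v + G2 x u v)"
  proof (intro conjI allI)
    show "((\<lambda>x. f x + g x) has_derivative (\<lambda>u. F x u + G x u)) (at x)" for x
      by (intro has_derivative_add F' G')
    show "((\<lambda>x. F x u + G x u) has_derivative (\<lambda>v. F2 x u v + G2 x u v)) (at x)" for x u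
      by (intro has_derivative_add F' G')
    show "F2 x u v + G2 x u v = F2 x v u + G2 x v u" for x u v
      using F[THEN conjunct2, THEN conjunct2, rule_format, of x u v]
        G[THEN conjunct2, THEN conjunct2, rule_format, of x u v] by linarith
  qed
  then show ?case by (intro exI)
next
  case (mult f g)
  obtain F F2 where F: "?P f F F2" using mult.IH(1) by (elim exE)
  obtain G G2 where G: "?P g G G2" using mult.IH(2) by (elim exE)
  note F' = F[THEN conjunct1, rule_format] F[THEN conjunct2, THEN conjunct1, rule_format]
  note G' = G[THEN conjunct1, rule_format] G[THEN conjunct2, THEN conjunct1, rule_format]
  have "?P (\<lambda>x. f x * g x) (\<lambda>x u. f x * G x u + F x u * g x)
    (\<lambda>x u v. (f x * G2 x u v + F x v * G x u) + (F x u * G x v + F2 x u v * g x))"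
  proof (intro conjI allI)
    show "((\<lambda>x. f x * g x) has_derivative (\<lambda>u. f x * G x u + F x u * g x)) (at x)" for x
      by (intro has_derivative_mult F' G')
    show "((\<lambda>x. f x * G x u + F x u * g x) has_derivative
        (\<lambda>v. (f x * G2 x u v + F x v * G x u) + (F x u * G x v + F2 x u v * g x))) (at x)" for x u
      by (intro has_derivative_add has_derivative_mult F' G')
    show "(f x * G2 x u v + F x v * G x u) + (F x u * G x v + F2 x u v * g x)
        = (f x * G2 x v u + F x u * G x v) + (F x v * G x u + F2 x v u * g x)" for x u v
      unfolding F[THEN conjunct2, THEN conjunct2, rule_format, of x u v]
        G[THEN conjunct2, THEN conjunct2, rule_format, of x u v] by linarith
  qed
  then show ?case by (intro exI)
qed

lemma polynomial_function_second_derivative: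
  fixes q :: "'a::real_normed_vector \<Rightarrow> 'b::euclidean_space"
  assumes "polynomial_function q"
  shows "\<exists>F G. (\<forall>x. (q has_derivative F x) (at x)) \<and>
    (\<forall>x v. ((\<lambda>x. F x v) has_derivative G x v) (at x)) \<and> (\<forall>x u v. G x u v = G x v u)"
proof -
  have "\<forall>b\<in>Basis. \<exists>F G. (\<forall>x. ((\<lambda>x. inner (q x) b) has_derivative F x) (at x)) \<and>
    (\<forall>x v. ((\<lambda>x. F x v) has_derivative G x v) (at x)) \<and> (\<forall>x u v. G x u v = G x v u)"
    using assms unfolding polynomial_function_iff_Basis_inner
    by (intro ballI real_polynomial_function_second_derivative) (rule bspec)
  from this[THEN bchoice] obtain F where "\<forall>b\<in>Basis. \<exists>G.
      (\<forall>x. ((\<lambda>x. inner (q x) b) has_derivative F b x) (at x)) \<and>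
      (\<forall>x v. ((\<lambda>x. F b x v) has_derivative G x v) (at x)) \<and> (\<forall>x u v. G x u v = G x v u)" ..
  from this[THEN bchoice] obtain G where FG: "\<forall>b\<in>Basis.
      (\<forall>x. ((\<lambda>x. inner (q x) b) has_derivative F b x) (at x)) \<and>
      (\<forall>x v. ((\<lambda>x. F b x v) has_derivative G b x v) (at x)) \<and>
      (\<forall>x u v. G b x u v = G b x v u)" ..
  note FG' = FG[rule_format, THEN conjunct1, rule_format]
    FG[rule_format, THEN conjunct2, THEN conjunct1, rule_format]
    FG[rule_format, THEN conjunct2, THEN conjunct2, rule_format]
  show ?thesis
  proof (intro exI conjI allI)
    show "(q has_derivative (\<lambda>v. \<Sum>b\<in>Basis. F b x v *\<^sub>R b)) (at x)" for x
    proof -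
      have "((\<lambda>x. \<Sum>b\<in>Basis. inner (q x) b *\<^sub>R b) has_derivative
          (\<lambda>v. \<Sum>b\<in>Basis. F b x v *\<^sub>R b)) (at x)"
        by (intro has_derivative_sum has_derivative_scaleR_left FG')
      then show ?thesis by (simp only: euclidean_representation)
    qed
    show "((\<lambda>x. \<Sum>b\<in>Basis. F b x v *\<^sub>R b) has_derivative
        (\<lambda>u. \<Sum>b\<in>Basis. G b x v u *\<^sub>R b)) (at x)" for x v
      by (intro has_derivative_sum has_derivative_scaleR_left FG')
    show "(\<Sum>b\<in>Basis. G b x u v *\<^sub>R b) = (\<Sum>b\<in>Basis. G b x v u *\<^sub>R b)" for x u v
      by (intro sum.cong refl arg_cong2[where f = scaleR] FG'(3))
  qed
qed

lemma has_derivative_along_line: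
  assumes "(q has_derivative q') (at w)"
  shows "((\<lambda>t::real. q (w + t *\<^sub>R v)) has_vector_derivative q' v) (at 0)"
proof -
  have "((\<lambda>t. w + t *\<^sub>R v) has_derivative (\<lambda>t. t *\<^sub>R v)) (at 0)"
    by (auto intro!: derivative_eq_intros)
  moreover have "(q has_derivative q') (at (w + 0 *\<^sub>R v))" using assms by simp
  ultimately have "((\<lambda>t. q (w + t *\<^sub>R v)) has_derivative (\<lambda>t. q' (t *\<^sub>R v))) (at 0)"
    by (rule has_derivative_compose)
  then show ?thesis
    by (simp add: has_vector_derivative_def linear_scale[OF has_derivative_linear[OF assms]])
qed

text \<open>
  First and second directional derivatives as they are seen from a subspace \<open>H\<close>: \<open>p\<close> is
  differentiated only along lines in \<open>H\<close>, whereas \<open>F\<close> and \<open>G\<close> stand for the derivatives of a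
  polynomial extension of \<open>p\<close> and are therefore constrained at every point.
\<close>
definition directional_derivatives ::
  "'a::real_normed_vector set \<Rightarrow> ('a \<Rightarrow> 'b::real_normed_vector) \<Rightarrow>
    ('a \<Rightarrow> 'a \<Rightarrow> 'b) \<Rightarrow> ('a \<Rightarrow> 'a \<Rightarrow> 'a \<Rightarrow> 'b) \<Rightarrow> bool" where
  "directional_derivatives H p F G \<longleftrightarrow>
     (\<forall>w. linear (F w)) \<and>
     (\<forall>w\<in>H. \<forall>v\<in>H. ((\<lambda>t. p (w + t *\<^sub>R v)) has_vector_derivative F w v) (at 0)) \<and>
     (\<forall>w u v. ((\<lambda>t. F (w + t *\<^sub>R v) u) has_vector_derivative G w u v) (at 0)) \<and>
     (\<forall>w u v. G w u v = G w v u)"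

lemma directional_derivativesD:
  assumes "directional_derivatives H p F G"
  shows "linear (F w)"
    and "w \<in> H \<Longrightarrow> v \<in> H \<Longrightarrow> ((\<lambda>t. p (w + t *\<^sub>R v)) has_vector_derivative F w v) (at 0)"
    and "((\<lambda>t. F (w + t *\<^sub>R v) u) has_vector_derivative G w u v) (at 0)"
    and "G w u v = G w v u"
  using assms unfolding directional_derivatives_def by simp_all

lemma homogeneous_polys_directional_derivatives:
  assumes H: "subspace H" and p: "p \<in> homogeneous_polys k H"
  shows "\<exists>F G. directional_derivatives H p F G"
proof -
  obtain q where q: "polynomial_function q" "\<And>v. v \<in> H \<Longrightarrow> p v = q v"
    using p unfolding homogeneous_polys_def by blast
  obtain F G where F: "\<forall>x. (q has_derivative F x) (at x)"
    and G: "\<forall>x v. ((\<lambda>x. F x v) has_derivative G x v) (at x)"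
    and sym: "\<forall>x u v. G x u v = G x v u"
    using polynomial_function_second_derivative[OF q(1)] by (elim exE conjE) (rule that)
  have d1: "((\<lambda>t. p (w + t *\<^sub>R v)) has_vector_derivative F w v) (at 0)"
    if "w \<in> H" "v \<in> H" for w v
  proof -
    have "(\<lambda>t. p (w + t *\<^sub>R v)) = (\<lambda>t. q (w + t *\<^sub>R v))"
      using H that by (auto intro!: q(2) subspace_add subspace_scale)
    then show ?thesis using has_derivative_along_line[OF F[rule_format]] by simp
  qed
  have d2: "((\<lambda>t. F (w + t *\<^sub>R v) u) has_vector_derivative G w u v) (at 0)" for w u v
    by (rule has_derivative_along_line[OF G[rule_format]])
  have "linear (F w)" for w
    by (rule has_derivative_linear[OF F[rule_format]])
  then have "directional_derivatives H p F G"
    unfolding directional_derivatives_def by (intro conjI allI ballI d1 d2 sym[rule_format])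
  then show ?thesis by (intro exI)
qed

lemma dir_deriv_eqI:
  assumes "((\<lambda>t. p (w + t *\<^sub>R v)) has_vector_derivative d) (at 0)"
  shows "dir_deriv v p w = d"
  using assms unfolding dir_deriv_def by (rule vector_derivative_at)

lemma has_vector_derivative_clifford_mult_left:
  assumes "(f has_vector_derivative d) F"
  shows "((\<lambda>t. (c :: 'm::finite clifford) * f t) has_vector_derivative c * d) F"
  by (rule bounded_linear.has_vector_derivative[OF
        bounded_bilinear.bounded_linear_right[OF bounded_bilinear_clifford_mult] assms])

text \<open>
  Euler's identity: along the ray through \<open>w\<close> the polynomial is \<open>(1 + t)\<^sup>k p(w)\<close>.
\<close>
lemma euler_homogeneous:
  assumes p: "p \<in> homogeneous_polys k H" and w: "w \<in> H"
    and d: "((\<lambda>t. p (w + t *\<^sub>R w)) has_vector_derivative d) (at 0)"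
  shows "d = real k *\<^sub>R p w"
proof -
  have "(\<lambda>t. p (w + t *\<^sub>R w)) = (\<lambda>t. (1 + t) ^ k *\<^sub>R p w)"
  proof
    fix t
    have "p ((1 + t) *\<^sub>R w) = (1 + t) ^ k *\<^sub>R p w"
      using p w unfolding homogeneous_polys_def by blast
    then show "p (w + t *\<^sub>R w) = (1 + t) ^ k *\<^sub>R p w" by (simp add: scaleR_add_left)
  qed
  moreover have "((\<lambda>t::real. (1 + t) ^ k *\<^sub>R p w) has_vector_derivative real k *\<^sub>R p w) (at 0)"
    unfolding has_vector_derivative_def by (auto intro!: derivative_eq_intros)
  ultimately show ?thesis using vector_derivative_unique_at[OF d] by simp
qed


section \<open>Monogenic polynomials are harmonic\<close>

text \<open>
  \<open>D\<^sup>2 = -\<Delta>\<close>: in \<open>\<Sum> b c \<partial>\<^sub>b \<partial>\<^sub>c p\<close> the mixed derivatives are symmetric, so \<open>b c\<close>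
  may be replaced by half of \<open>b c + c b\<close>, which vanishes off the diagonal.
\<close>
lemma monogenic_polys_subset_harmonic_polys:
  assumes H: "subspace H" "H \<subseteq> vectors"
  shows "monogenic_polys k H \<subseteq> harmonic_polys k H"
proof
  fix p assume "p \<in> monogenic_polys k H"
  then have p: "p \<in> homogeneous_polys k H" and D: "\<And>w. w \<in> H \<Longrightarrow> dirac H p w = 0"
    unfolding monogenic_polys_def by auto
  obtain F G where FG: "directional_derivatives H p F G"
    using homogeneous_polys_directional_derivatives[OF H(1) p] by (elim exE)
  note F = directional_derivativesD(2)[OF FG] and G = directional_derivativesD(3)[OF FG]
    and sym = directional_derivativesD(4)[OF FG]
  define B where "B = some_onb H"
  have B: "orthonormal_basis H B" unfolding B_def by (rule orthonormal_basis_some_onb[OF H(1)])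
  have BH: "B \<subseteq> H" by (rule orthonormal_basis_subset[OF B])
  have fin: "finite B" by (rule orthonormal_basis_finite[OF B])
  have dF: "dir_deriv v p w = F w v" if "w \<in> H" "v \<in> H" for v w
    using F[OF that] by (rule dir_deriv_eqI)
  have D0: "(\<Sum>c\<in>B. c * F w c) = 0" if "w \<in> H" for w
  proof -
    have "(\<Sum>c\<in>B. c * F w c) = dirac H p w"
      unfolding dirac_def B_def[symmetric]
      using that BH by (intro sum.cong refl) (auto simp: dF)
    then show ?thesis using D[OF that] by simp
  qed
  \<comment> \<open>\<open>D p\<close> vanishes on all of \<open>H\<close>, hence so does its derivative in a direction in \<open>H\<close>\<close>
  have DD: "(\<Sum>c\<in>B. c * G w c b) = 0" if w: "w \<in> H" and b: "b \<in> H" for w b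
  proof -
    have "((\<lambda>t. \<Sum>c\<in>B. c * F (w + t *\<^sub>R b) c) has_vector_derivative (\<Sum>c\<in>B. c * G w c b)) (at 0)"
      by (intro has_vector_derivative_sum has_vector_derivative_clifford_mult_left G)
    moreover have "(\<lambda>t. \<Sum>c\<in>B. c * F (w + t *\<^sub>R b) c) = (\<lambda>t. 0)"
      using H(1) w b by (intro ext D0) (auto intro: subspace_add subspace_scale)
    ultimately show ?thesis
      using vector_derivative_unique_at[OF _ has_vector_derivative_const] by simp
  qed
  have "laplacian H p w = 0" if w: "w \<in> H" for w
  proof -
    have "dir_deriv b (dir_deriv b p) w = G w b b" if b: "b \<in> H" for b
    proof (rule dir_deriv_eqI)
      have "(\<lambda>t. dir_deriv b p (w + t *\<^sub>R b)) = (\<lambda>t. F (w + t *\<^sub>R b) b)"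
        using H(1) w b by (intro ext dF) (auto intro: subspace_add subspace_scale)
      then show "((\<lambda>t. dir_deriv b p (w + t *\<^sub>R b)) has_vector_derivative G w b b) (at 0)"
        using G by simp
    qed
    then have L: "laplacian H p w = (\<Sum>b\<in>B. G w b b)"
      unfolding laplacian_def B_def[symmetric] using BH by (intro sum.cong refl) auto
    define S where "S = (\<Sum>b\<in>B. \<Sum>c\<in>B. b * (c * G w c b))"
    have S0: "S = 0"
      unfolding S_def sum_distrib_left[symmetric] using BH by (auto intro!: sum.neutral simp: DD w)
    \<comment> \<open>symmetrise: exchange the roles of \<open>b\<close> and \<open>c\<close>, then use the symmetry of \<open>G\<close>\<close>
    have "S = (\<Sum>c\<in>B. \<Sum>b\<in>B. b * (c * G w c b))"
      unfolding S_def by (rule sum.swap)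
    also have "\<dots> = (\<Sum>b\<in>B. \<Sum>c\<in>B. c * (b * G w c b))"
      by (intro sum.cong refl arg_cong2[where f = "(*)"] sym)
    finally have "S = (\<Sum>b\<in>B. \<Sum>c\<in>B. c * (b * G w c b))" .
    then have "S + S = S + (\<Sum>b\<in>B. \<Sum>c\<in>B. c * (b * G w c b))"
      by (simp only:)
    also have "\<dots> = (\<Sum>b\<in>B. \<Sum>c\<in>B. (b * c + c * b) * G w c b)"
      by (simp add: S_def sum.distrib distrib_right mult.assoc)
    also have "\<dots> = (\<Sum>b\<in>B. \<Sum>c\<in>B. (if b = c then - 2 *\<^sub>R G w c b else 0))"
    proof (intro sum.cong refl)
      fix b c assume bc: "b \<in> B" "c \<in> B"
      then have "b * c + c * b = (- 2 * inner b c) *\<^sub>R 1"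
        using BH H(2) by (intro vectors_anticommute) auto
      then show "(b * c + c * b) * G w c b = (if b = c then - 2 *\<^sub>R G w c b else 0)"
        by (simp add: orthonormal_basis_inner[OF B bc])
    qed
    also have "\<dots> = - 2 *\<^sub>R (\<Sum>b\<in>B. G w b b)"
      using fin by (simp add: scaleR_sum_right)
    finally show ?thesis using S0 L by simp
  qed
  then show "p \<in> harmonic_polys k H" using p by (simp add: harmonic_polys_def)
qed


section \<open>Directness of the Almansi-Fischer decomposition\<close>

text \<open>
  The computation \<open>D (w q) = -(n + 2 j) q\<close>.  The product rule gives
  \<open>\<Sum> b b q + \<Sum> b w \<partial>\<^sub>b q\<close>; the first sum is \<open>-n q\<close>, and moving \<open>b\<close> past \<open>w\<close> turns the
  second into \<open>-w D q - 2 \<partial>\<^sub>w q\<close>, where \<open>D q = 0\<close> and \<open>\<partial>\<^sub>w q = j q\<close> by Euler.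
\<close>
lemma monogenic_times_variable_derivative:
  assumes H: "subspace H" "H \<subseteq> vectors" and q: "q \<in> monogenic_polys j H"
    and B: "orthonormal_basis H B" and FG: "directional_derivatives H q F G" and w: "w \<in> H"
  shows "v \<in> H \<Longrightarrow>
      ((\<lambda>t. (w + t *\<^sub>R v) * q (w + t *\<^sub>R v)) has_vector_derivative w * F w v + v * q w) (at 0)"
    and "(\<Sum>b\<in>B. b * (w * F w b + b * q w)) = - (real (card B + 2 * j) *\<^sub>R q w)"
proof -
  have qh: "q \<in> homogeneous_polys j H" and D: "\<And>w. w \<in> H \<Longrightarrow> dirac H q w = 0"
    using q unfolding monogenic_polys_def by auto
  have BH: "B \<subseteq> H" by (rule orthonormal_basis_subset[OF B])
  note lin = directional_derivativesD(1)[OF FG] and F = directional_derivativesD(2)[OF FG]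
  show "((\<lambda>t. (w + t *\<^sub>R v) * q (w + t *\<^sub>R v)) has_vector_derivative w * F w v + v * q w) (at 0)"
    if "v \<in> H"
  proof -
    have "((\<lambda>t. w + t *\<^sub>R v) has_vector_derivative v) (at 0)"
      unfolding has_vector_derivative_def by (auto intro!: derivative_eq_intros)
    from bounded_bilinear.has_vector_derivative[OF bounded_bilinear_clifford_mult this F[OF w that]]
    show ?thesis by simp
  qed
  have "b * (w * F w b + b * q w)
      = - (w * (b * F w b)) - 2 *\<^sub>R F w (inner w b *\<^sub>R b) - q w" if b: "b \<in> B" for b
  proof -
    have v: "b \<in> vectors" "w \<in> vectors" using b w BH H(2) by auto
    have "b * w = - (w * b) - (2 * inner w b) *\<^sub>R 1"
      using vectors_anticommute[OF v(2,1)] by (simp add: algebra_simps eq_neg_iff_add_eq_0)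
    then have "b * (w * F w b) = - (w * (b * F w b)) - (2 * inner w b) *\<^sub>R F w b"
      by (simp add: mult.assoc[symmetric] left_diff_distrib)
    moreover have "b * (b * q w) = - q w"
      using vector_square[OF v(1)] orthonormal_basis_inner[OF B b b]
      by (simp add: mult.assoc[symmetric])
    ultimately show ?thesis by (simp add: distrib_left linear_scale[OF lin])
  qed
  then have "(\<Sum>b\<in>B. b * (w * F w b + b * q w))
      = (\<Sum>b\<in>B. - (w * (b * F w b)) - 2 *\<^sub>R F w (inner w b *\<^sub>R b) - q w)"
    by (intro sum.cong refl)
  also have "\<dots> = - (w * (\<Sum>b\<in>B. b * F w b)) - 2 *\<^sub>R F w (\<Sum>b\<in>B. inner w b *\<^sub>R b)
        - real (card B) *\<^sub>R q w"
    by (simp only: sum_subtractf sum_negf sum_distrib_left linear_sum[OF lin] scaleR_sum_right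
        sum_constant_scaleR)
  also have "(\<Sum>b\<in>B. b * F w b) = dirac H q w"
    unfolding dirac_eq_sum_onb[OF H(1) qh w B]
    using BH w by (intro sum.cong refl arg_cong2[where f = "(*)"] dir_deriv_eqI[symmetric] F) auto
  also have "F w (\<Sum>b\<in>B. inner w b *\<^sub>R b) = real j *\<^sub>R q w"
    unfolding orthonormal_basis_expansion[OF B w]
    by (rule euler_homogeneous[OF qh w F[OF w w]])
  also have "- (w * dirac H q w) - 2 *\<^sub>R real j *\<^sub>R q w - real (card B) *\<^sub>R q w
      = - (real (card B + 2 * j) *\<^sub>R q w)"
    by (simp add: D[OF w] algebra_simps)
  finally show "(\<Sum>b\<in>B. b * (w * F w b + b * q w)) = - (real (card B + 2 * j) *\<^sub>R q w)" .
qed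

text \<open>
  If \<open>p\<close> and \<open>p'\<close> are monogenic then so is their difference \<open>w q\<close>, whence
  \<open>(n + 2 j) q = 0\<close>.  The coefficient is nonzero exactly when \<open>n > 0\<close> or \<open>j > 0\<close>, and
  \<open>H \<noteq> {0}\<close> provides the former.
\<close>
lemma monogenic_decomposition_unique:
  assumes H: "subspace H" "H \<subseteq> vectors" "H \<noteq> {0}"
    and p: "p \<in> monogenic_polys k H" and p': "p' \<in> monogenic_polys k H"
    and r: "r \<in> fischer_complement k H" and eq: "\<And>w. w \<in> H \<Longrightarrow> p w = p' w + r w"
  shows "p' = p"
proof -
  have ph: "p \<in> homogeneous_polys k H" and Dp: "\<And>w. w \<in> H \<Longrightarrow> dirac H p w = 0"
    and ph': "p' \<in> homogeneous_polys k H" and Dp': "\<And>w. w \<in> H \<Longrightarrow> dirac H p' w = 0"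
    using p p' unfolding monogenic_polys_def by auto
  have "r w = 0" if w: "w \<in> H" for w
  proof (cases k)
    case 0
    then show ?thesis using r w by (simp add: fischer_complement_def)
  next
    case (Suc j)
    then obtain q where q: "q \<in> monogenic_polys j H" and rq: "r = (\<lambda>w\<in>H. w * q w)"
      using r by (auto simp: fischer_complement_def)
    define B where "B = some_onb H"
    have B: "orthonormal_basis H B" unfolding B_def by (rule orthonormal_basis_some_onb[OF H(1)])
    have BH: "B \<subseteq> H" by (rule orthonormal_basis_subset[OF B])
    obtain F G where FG: "directional_derivatives H p' F G"
      using homogeneous_polys_directional_derivatives[OF H(1) ph'] by (elim exE)
    note F = directional_derivativesD(2)[OF FG]
    have qh: "q \<in> homogeneous_polys j H" using q by (simp add: monogenic_polys_def)
    obtain Q G' where Q: "directional_derivatives H q Q G'"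
      using homogeneous_polys_directional_derivatives[OF H(1) qh] by (elim exE)
    define R where "R b = w * Q w b + b * q w" for b
    note R = monogenic_times_variable_derivative(1)[OF H(1,2) q B Q w, folded R_def]
      and DR = monogenic_times_variable_derivative(2)[OF H(1,2) q B Q w, folded R_def]
    have dd: "dir_deriv b p w = dir_deriv b p' w + R b" if b: "b \<in> B" for b
    proof -
      have bH: "b \<in> H" using b BH by blast
      have "w + t *\<^sub>R b \<in> H" for t
        using H(1) w bH by (intro subspace_add subspace_scale)
      then have "(\<lambda>t. p (w + t *\<^sub>R b)) = (\<lambda>t. p' (w + t *\<^sub>R b) + (w + t *\<^sub>R b) * q (w + t *\<^sub>R b))"
        by (simp add: eq rq)
      then have "((\<lambda>t. p (w + t *\<^sub>R b)) has_vector_derivative F w b + R b) (at 0)"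
        using has_vector_derivative_add[OF F[OF w bH] R[OF bH]] by simp
      then show ?thesis
        unfolding dir_deriv_eqI[OF F[OF w bH]] by (rule dir_deriv_eqI)
    qed
    have "dirac H p w = (\<Sum>b\<in>B. b * dir_deriv b p' w) + (\<Sum>b\<in>B. b * R b)"
      unfolding dirac_eq_sum_onb[OF H(1) ph w B]
      by (simp add: dd distrib_left sum.distrib)
    then have "real (card B + 2 * j) *\<^sub>R q w = 0"
      using Dp[OF w] Dp'[OF w] DR by (simp add: dirac_eq_sum_onb[OF H(1) ph' w B])
    moreover have "card B \<noteq> 0"
      using B H(3) orthonormal_basis_finite[OF B] by (auto simp: orthonormal_basis_def)
    ultimately have "q w = 0" by auto
    then show ?thesis by (simp add: rq w)
  qed
  moreover have "p \<in> extensional H" "p' \<in> extensional H"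
    using ph ph' by (simp_all add: homogeneous_polys_def)
  ultimately show ?thesis by (intro extensionalityI[of p' H p]) (simp_all add: eq)
qed

lemma zero_in_monogenic_polys:
  assumes "subspace H"
  shows "(\<lambda>w\<in>H. 0) \<in> monogenic_polys k H"
proof -
  have hom: "(\<lambda>w\<in>H. 0) \<in> homogeneous_polys k H"
    using assms by (auto simp: homogeneous_polys_def subspace_scale intro!: exI[of _ "\<lambda>w. 0"])
  have "dir_deriv v (\<lambda>w\<in>H. 0) w = 0" if "w \<in> H" "v \<in> H" for v w
    using assms that
    by (intro dir_deriv_eqI) (simp add: subspace_add subspace_scale has_vector_derivative_const)
  moreover have "some_onb H \<subseteq> H"
    by (intro orthonormal_basis_subset orthonormal_basis_some_onb assms)
  ultimately show ?thesis
    using hom by (auto simp: monogenic_polys_def dirac_def intro!: sum.neutral)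
qed

lemma fischer_proj_monogenic:
  assumes H: "subspace H" "H \<subseteq> vectors" "H \<noteq> {0}" and p: "p \<in> monogenic_polys k H"
  shows "fischer_proj k H p = p"
proof -
  have "(\<lambda>w\<in>H. 0) \<in> fischer_complement k H"
  proof (cases k)
    case (Suc j)
    have "(\<lambda>w\<in>H. 0) \<in> (\<lambda>q. \<lambda>w\<in>H. w * q w) ` monogenic_polys j H"
      by (rule image_eqI[where x = "\<lambda>w\<in>H. 0"])
        (auto intro: zero_in_monogenic_polys[OF H(1)])
    then show ?thesis by (simp add: fischer_complement_def Suc)
  qed (simp add: fischer_complement_def)
  then have "\<exists>r\<in>fischer_complement k H. \<forall>w\<in>H. p w = p w + r w" by (rule bexI[rotated]) simp
  then have "(THE p'. p' \<in> monogenic_polys k H \<and>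
      (\<exists>r\<in>fischer_complement k H. \<forall>w\<in>H. p w = p' w + r w)) = p"
    using p monogenic_decomposition_unique[OF H p] by (intro the_equality) blast+
  moreover have "p \<in> harmonic_polys k H"
    using monogenic_polys_subset_harmonic_polys[OF H(1,2)] p by blast
  ultimately show ?thesis by (simp add: fischer_proj_def)
qed


section \<open>Transport of monogenic polynomials by a reflection\<close>

text \<open>
  With \<open>g(w) = s a p(a w a)\<close> and the basis \<open>a b a\<close> of the reflected subspace, each term of the
  Dirac operator is \<open>(a b a) (s a) \<partial>\<^sub>b p = - s a (b \<partial>\<^sub>b p)\<close> since \<open>a\<^sup>2 = -1\<close>; the constant
  \<open>- s a\<close> comes out on the left and leaves \<open>D p = 0\<close>.  The left factor \<open>a\<close> is what makes this
  work: it is the reason for the vector-valued weight in the theorem.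
\<close>
lemma monogenic_polys_unit_vector_conj:
  assumes a: "a \<in> unit_vectors" and K: "subspace K" "K \<subseteq> vectors" and p: "p \<in> monogenic_polys k K"
  defines "H \<equiv> {w \<in> vectors. a * w * a \<in> K}"
  shows "(\<lambda>w\<in>H. s *\<^sub>R a * p (a * w * a)) \<in> monogenic_polys k H"
proof -
  let ?c = "\<lambda>w. a * w * a" and ?g = "\<lambda>w\<in>H. s *\<^sub>R a * p (a * w * a)"
  have ph: "p \<in> homogeneous_polys k K" and D: "\<And>w. w \<in> K \<Longrightarrow> dirac K p w = 0"
    using p unfolding monogenic_polys_def by auto
  obtain F G where FG: "directional_derivatives K p F G"
    using homogeneous_polys_directional_derivatives[OF K(1) ph] by (elim exE)
  note F = directional_derivativesD(2)[OF FG]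
  define B where "B = some_onb K"
  have B: "orthonormal_basis K B" unfolding B_def by (rule orthonormal_basis_some_onb[OF K(1)])
  have BK: "B \<subseteq> K" by (rule orthonormal_basis_subset[OF B])
  have C: "orthonormal_basis H (?c ` B)"
    unfolding H_def by (rule orthonormal_basis_unit_vector_conj[OF a K(2) B])
  have H: "subspace H" unfolding H_def by (rule subspace_unit_vector_conj[OF K(1)])
  obtain q where q: "polynomial_function q" "\<And>v. v \<in> K \<Longrightarrow> p v = q v"
    using ph unfolding homogeneous_polys_def by blast
  have "polynomial_function (q \<circ> ?c)"
    using linear_conv_bounded_linear linear_clifford_sandwich
    by (intro polynomial_function_compose q polynomial_function_bounded_linear) blast
  moreover have "bounded_linear (\<lambda>z. s *\<^sub>R a * z)"
    by (rule bounded_bilinear.bounded_linear_right[OF bounded_bilinear_clifford_mult])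
  ultimately have "polynomial_function ((\<lambda>z. s *\<^sub>R a * z) \<circ> (q \<circ> ?c))"
    by (rule polynomial_function_compose[OF _ polynomial_function_bounded_linear])
  then have "\<exists>q. polynomial_function q \<and> (\<forall>w\<in>H. ?g w = q w)"
    by (intro exI[of _ "(\<lambda>z. s *\<^sub>R a * z) \<circ> (q \<circ> ?c)"]) (simp add: H_def q(2))
  moreover have "?g (t *\<^sub>R w) = t ^ k *\<^sub>R ?g w" if w: "w \<in> H" for w t
  proof -
    have "p (t *\<^sub>R ?c w) = t ^ k *\<^sub>R p (?c w)"
      using ph w unfolding homogeneous_polys_def H_def by blast
    then show ?thesis using w subspace_scale[OF H w] by (simp add: mult.assoc)
  qed
  ultimately have hom: "?g \<in> homogeneous_polys k H" by (simp add: homogeneous_polys_def)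
  have "dirac H ?g w = 0" if w: "w \<in> H" for w
  proof -
    have wK: "?c w \<in> K" using w by (simp add: H_def)
    have dd: "dir_deriv (?c b) ?g w = s *\<^sub>R a * F (?c w) b" if b: "b \<in> B" for b
    proof (rule dir_deriv_eqI)
      have bK: "b \<in> K" and cb: "?c b \<in> H"
        using b BK orthonormal_basis_subset[OF C] by auto
      have "?g (w + t *\<^sub>R ?c b) = s *\<^sub>R a * p (?c w + t *\<^sub>R b)" for t
      proof -
        have "w + t *\<^sub>R ?c b \<in> H" using H w cb by (intro subspace_add subspace_scale)
        moreover have "?c (w + t *\<^sub>R ?c b) = ?c w + t *\<^sub>R ?c (?c b)"
          by (simp add: distrib_left distrib_right)
        ultimately show ?thesis unfolding unit_vector_conj_conj[OF a] by simp
      qed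
      then have line: "(\<lambda>t. ?g (w + t *\<^sub>R ?c b)) = (\<lambda>t. s *\<^sub>R a * p (?c w + t *\<^sub>R b))"
        by (rule ext)
      show "((\<lambda>t. ?g (w + t *\<^sub>R ?c b)) has_vector_derivative s *\<^sub>R a * F (?c w) b) (at 0)"
        unfolding line by (rule has_vector_derivative_clifford_mult_left[OF F[OF wK bK]])
    qed
    have "inj ?c"
      by (rule inj_on_inverseI[where g = ?c]) (rule unit_vector_conj_conj[OF a])
    then have "dirac H ?g w = (\<Sum>b\<in>B. ?c b * dir_deriv (?c b) ?g w)"
      unfolding dirac_eq_sum_onb[OF H hom w C] by (simp add: sum.reindex inj_on_subset)
    also have "\<dots> = (\<Sum>b\<in>B. - (s *\<^sub>R a) * (b * dir_deriv b p (?c w)))"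
    proof (intro sum.cong refl)
      fix b assume b: "b \<in> B"
      have "?c b * (s *\<^sub>R a * F (?c w) b) = s *\<^sub>R (a * b * (a * a) * F (?c w) b)"
        by (simp add: mult.assoc)
      also have "\<dots> = - (s *\<^sub>R a) * (b * F (?c w) b)"
        by (simp add: unit_vector_square[OF a] mult.assoc)
      finally show "?c b * dir_deriv (?c b) ?g w = - (s *\<^sub>R a) * (b * dir_deriv b p (?c w))"
        using dd[OF b] dir_deriv_eqI[OF F[OF wK]] b BK by (simp add: subset_iff)
    qed
    also have "\<dots> = - (s *\<^sub>R a) * dirac K p (?c w)"
      unfolding dirac_eq_sum_onb[OF K(1) ph wK B] by (rule sum_distrib_left[symmetric])
    finally show ?thesis by (simp add: D[OF wK])
  qed
  then show ?thesis using hom by (simp add: monogenic_polys_def)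
qed


section \<open>Covariance of the projection under the Cayley transformation\<close>

theorem theorem1:
  fixes k :: nat
    and U :: "'n::finite option clifford set"
    and f :: "'n option clifford \<Rightarrow> 'n option clifford \<Rightarrow> 'n option clifford"
  assumes "openin (top_of_set unit_vectors) U" and "connected U" and "U \<noteq> {}"
    and "\<And>y. y \<in> U \<Longrightarrow> (\<lambda>u\<in>hyper_vectors. f y u) \<in> monogenic_polys k hyper_vectors"
  shows "\<forall>x\<in>hyper_vectors. cayley x \<in> U \<longrightarrow>
    (let a = (x + e_last) /\<^sub>R norm (x + e_last);
         H = {w \<in> vectors. a * w * a \<in> hyper_vectors};
         u = (\<lambda>w. ((x + e_last) * w * (x + e_last)) /\<^sub>R (norm (x + e_last))\<^sup>2)
     in \<forall>w\<in>H. u w \<in> hyper_vectors \<and>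
          fischer_proj k H (\<lambda>w\<in>H. cayley_weight x * f (cayley x) (u w)) w
          = cayley_weight x * fischer_proj k hyper_vectors (\<lambda>v\<in>hyper_vectors. f (cayley x) v) (u w))"
proof (intro ballI impI)
  fix x :: "'n option clifford"
  assume x: "x \<in> hyper_vectors" and xU: "cayley x \<in> U"
  define m where "m = norm (x + e_last)"
  define a where "a = (x + e_last) /\<^sub>R m"
  define H where "H = {w \<in> vectors. a * w * a \<in> hyper_vectors}"
  define p where "p = (\<lambda>v\<in>hyper_vectors. f (cayley x) v)"
  \<comment> \<open>\<open>s = m\<^bsup>1-n\<^esup>\<close>, the real factor with \<open>J = s a\<close>\<close>
  define s where "s = m / m ^ CARD('n)"
  have "inner (x + e_last) e_last = 1"
    by (simp add: inner_add_left inner_e_last_hyper_vectors[OF x] inner_gen)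
  then have m: "m > 0" unfolding m_def by auto
  have "x + e_last \<in> vectors"
    using x hyper_vectors_subset_vectors e_last_in_vectors
    by (auto intro: subspace_add[OF subspace_vectors])
  then have a: "a \<in> unit_vectors"
    using m by (auto simp: a_def unit_vectors_def m_def intro: subspace_scale[OF subspace_vectors])
  have u: "((x + e_last) * w * (x + e_last)) /\<^sub>R m\<^sup>2 = a * w * a" for w
    by (simp add: a_def power2_eq_square)
  have J: "cayley_weight x = s *\<^sub>R a"
    using m by (simp add: cayley_weight_def s_def a_def m_def[symmetric] field_simps)
  have p: "p \<in> monogenic_polys k hyper_vectors" unfolding p_def by (rule assms(4)[OF xU])
  \<comment> \<open>a nonzero vector of \<open>\<real>\<^sup>n\<close>, whose reflection is a nonzero vector of \<open>H\<close>\<close>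
  define e where "e = gen (Some (undefined :: 'n))"
  have e: "e \<in> hyper_vectors" unfolding hyper_vectors_def e_def by (auto intro: span_base)
  have e0: "e \<noteq> 0"
    using inner_gen[of "Some undefined :: 'n option" "Some undefined"] by (auto simp: e_def)
  then have nz: "(hyper_vectors :: 'n option clifford set) \<noteq> {0}" using e by blast
  have H: "subspace H" unfolding H_def by (rule subspace_unit_vector_conj[OF subspace_hyper_vectors])
  have "a * e * a \<in> H"
    using e hyper_vectors_subset_vectors
    by (auto simp: H_def unit_vector_conj_conj[OF a] intro: unit_vector_conj_in_vectors[OF a])
  moreover have "a * e * a \<noteq> 0"
    using unit_vector_conj_conj[OF a, of e] e0 by auto
  ultimately have "H \<noteq> {0}" by blast
  moreover have "H \<subseteq> vectors" by (auto simp: H_def)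
  moreover have "(\<lambda>w\<in>H. s *\<^sub>R a * p (a * w * a)) \<in> monogenic_polys k H"
    unfolding H_def
    by (rule monogenic_polys_unit_vector_conj[OF a subspace_hyper_vectors
          hyper_vectors_subset_vectors p])
  ultimately have PH: "fischer_proj k H (\<lambda>w\<in>H. s *\<^sub>R a * p (a * w * a))
      = (\<lambda>w\<in>H. s *\<^sub>R a * p (a * w * a))"
    by (intro fischer_proj_monogenic H)
  have Pp: "fischer_proj k hyper_vectors p = p"
    by (rule fischer_proj_monogenic[OF subspace_hyper_vectors hyper_vectors_subset_vectors nz p])
  have "(\<lambda>w\<in>H. s *\<^sub>R a * f (cayley x) (a * w * a)) = (\<lambda>w\<in>H. s *\<^sub>R a * p (a * w * a))"
    by (rule restrict_ext) (simp add: H_def p_def)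
  then have PHf: "fischer_proj k H (\<lambda>w\<in>H. s *\<^sub>R a * f (cayley x) (a * w * a)) w
      = s *\<^sub>R a * fischer_proj k hyper_vectors p (a * w * a)" if "w \<in> H" for w
    using that by (simp only: PH Pp restrict_apply')
  have "\<forall>w\<in>H. a * w * a \<in> hyper_vectors \<and>
      fischer_proj k H (\<lambda>w\<in>H. s *\<^sub>R a * f (cayley x) (a * w * a)) w
      = s *\<^sub>R a * fischer_proj k hyper_vectors p (a * w * a)"
    by (intro ballI conjI PHf) (simp_all add: H_def)
  then show "let a = (x + e_last) /\<^sub>R norm (x + e_last);
         H = {w \<in> vectors. a * w * a \<in> hyper_vectors};
         u = (\<lambda>w. ((x + e_last) * w * (x + e_last)) /\<^sub>R (norm (x + e_last))\<^sup>2)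
     in \<forall>w\<in>H. u w \<in> hyper_vectors \<and>
          fischer_proj k H (\<lambda>w\<in>H. cayley_weight x * f (cayley x) (u w)) w
          = cayley_weight x * fischer_proj k hyper_vectors (\<lambda>v\<in>hyper_vectors. f (cayley x) v) (u w)"
    unfolding Let_def m_def[symmetric] a_def[symmetric] H_def[symmetric] p_def[symmetric] u J .
qed

end
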